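(* Let $N\ge 1$, $\alpha\in\mathbb{C}$, and let $u_0,\ldots,u_N\in\mathbb{C}\setminus\Lambda_\tau$ be such that every function value below is defined. (a) For all $r,s\in\{0,\ldots,N\}$, the value of $\hat\mu_N$ at the point obtained from $(u_0,\ldots,u_N)$ by replacing $u_r$ with $u_r+\tau$ equals its value at the point obtained by replacing $u_s$ with $u_s+\tau$: $$\hat\mu_N(\ldots,u_r+\tau,\ldots;\alpha;\tau)=\hat\mu_N(\ldots,u_s+\tau,\ldots;\alpha;\tau).$$ (b) For every permutation $\sigma$ of $\{0,\ldots,N\}$, $$\hat\mu_N(u_0,\ldots,u_N;\alpha;\tau)=\hat\mu_N(u_{\sigma(0)},\ldots,u_{\sigma(N)};\alpha;\tau).$$
   Context: Fix $\tau\in\mathbb{C}$ with $\operatorname{Im}\tau>0$, put $q=e^{2\pi i\tau}$, $\Lambda_\tau=\mathbb{Z}+\tau\mathbb{Z}$, and $q^{\beta}:=e^{2\pi i\beta\tau}$ for $\beta\in\mathbb{C}$. $(x;q)_\infty=\prod_{j\ge0}(1-xq^j)$. The theta function is $\vartheta(u)=\vartheta(u;\tau)=\sum_{\nu\in\mathbb{Z}+1/2}e^{2\pi i\nu(u+1/2)}q^{\nu^2/2}=-ie^{-\pi iu}q^{1/8}(q;q)_\infty(e^{2\pi iu};q)_\infty(qe^{-2\pi iu};q)_\infty$. For $n=(n_1,\ldots,n_N)\in\mathbb{Z}^N$ put $|n|=n_1+\cdots+n_N$, and put $u=u_0+\cdots+u_N$. The multivariable generalized $\mu$-function is $$\hat\mu_N(u_0,\ldots,u_N;\alpha;\tau)=e^{\pi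 i(\alpha-1)u}\sum_{n\in\mathbb{Z}^N}\frac{e^{\pi iu_0}\,(e^{2\pi iu_0}q^{\alpha+|n|};q)_\infty}{(e^{2\pi iu_0}q^{|n|};q)_\infty}\prod_{j=1}^N\frac{(-1)^{n_j}e^{-2\pi in_ju_j}q^{n_j(n_j+1)/2}}{\vartheta(u_j;\tau)},$$ defined for $u_0,\ldots,u_N\notin\Lambda_\tau$. *)

theory Defs
  imports "HOL-Analysis.Analysis" "HOL-Combinatorics.Permutations"
begin

definition qpow :: "complex \<Rightarrow> complex \<Rightarrow> complex" where
  "qpow \<tau> \<beta> = exp (2 * pi * \<i> * \<beta> * \<tau>)"

definition nome :: "complex \<Rightarrow> complex" where
  "nome \<tau> = exp (2 * pi * \<i> * \<tau>)"

definition qpoch_inf :: "complex \<Rightarrow> complex \<Rightarrow> complex" where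
  "qpoch_inf x q = (\<Prod>j. (1 - x * q ^ j))"

definition lattice :: "complex \<Rightarrow> complex set" where
  "lattice \<tau> = {of_int a + of_int b * \<tau> | a b. True}"

definition theta :: "complex \<Rightarrow> complex \<Rightarrow> complex" where
  "theta u \<tau> = (\<Sum>\<^sub>\<infinity>k::int. let \<nu> = of_int k + 1/2 in
      exp (2 * pi * \<i> * \<nu> * (u + 1/2)) * qpow \<tau> (\<nu>^2 / 2))"

definition idxZ :: "nat \<Rightarrow> (nat \<Rightarrow> int) set" where
  "idxZ N = {n. \<forall>j. j \<notin> {1..N} \<longrightarrow> n j = 0}"

definition mu_hat :: "nat \<Rightarrow> (nat \<Rightarrow> complex) \<Rightarrow> complex \<Rightarrow> complex \<Rightarrow> complex" where
  "mu_hat N u \<alpha> \<tau> =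
     exp (pi * \<i> * (\<alpha> - 1) * (\<Sum>j\<le>N. u j)) *
     (\<Sum>\<^sub>\<infinity>n\<in>idxZ N.
        let m = of_int (\<Sum>j=1..N. n j) :: complex in
        exp (pi * \<i> * u 0) *
        qpoch_inf (exp (2 * pi * \<i> * u 0) * qpow \<tau> (\<alpha> + m)) (nome \<tau>) /
        qpoch_inf (exp (2 * pi * \<i> * u 0) * qpow \<tau> m) (nome \<tau>) *
        (\<Prod>j=1..N. ((-1) powi n j) * exp (- 2 * pi * \<i> * of_int (n j) * u j) *
             qpow \<tau> (of_int (n j * (n j + 1) div 2)) / theta (u j) \<tau>))"

end

theory Submission
  imports Defs
begin

text \<open>
Write $a = q^\alpha$ and $x_j = e^{2\pi i u_j}$. Multiplying the two Euler expansions of $(ax;q)_\infty$ and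
$(q/x;q)_\infty$ gives $(ax;q)_\infty (q/x;q)_\infty = \sum_n (-1)^n x^{-n} q^{n(n+1)/2} \kappa_n(a)$, where
$\kappa_n(a) = \sum_{j - i = n} a^i q^{ij} / ((q)_i (q)_j)$, and $\kappa_n(1)$ does not depend on $n$ (this is
Jacobi's triple product, up to the value of the constant). Replacing $x$ by $x q^m$ and dividing by the case $a = 1$
expands $(a x q^m;q)_\infty / (x q^m;q)_\infty$ as
$\sum_n (-1)^n x^{-n} q^{n(n+1)/2} \kappa_{n+m}(a)$ divided by a multiple of $\vartheta$. Hence $\hat\mu_N$ is a symmetric
elementary prefactor times
$\sum_{n \in Z^{N+1}} \kappa_{|n|}(a) \prod_{j=0}^N (-1)^{n_j} x_j^{-n_j} q^{n_j(n_j+1)/2} / \vartheta(u_j)$, which is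
visibly symmetric in all variables; shifting any one $u_r$ by $\tau$ turns $\kappa_{|n|}$ into $\kappa_{|n|+1}$.
The series converges absolutely because $\kappa_n$ grows at most exponentially.
\<close>

section \<open>Auxiliary facts on quotients, double series and bilateral series\<close>

text \<open>Serves \<open>qpoch_ratio\<close>, with A and B the two factors (y;q) and (q/y;q) of the
  triple product: it trades the factor B for a denominator A.\<close>

lemma cross_cancel:
  fixes A :: "'a::field"
  assumes "A * B = c * X" "A \<noteq> 0" "c \<noteq> 0"
  shows "P * B / c = P / A * X"
proof -
  have "P * B / c = P * (A * B) / (A * c)" using assms(2) by simp
  then show ?thesis unfolding assms(1) using assms(3) by simp
qed

lemma summable_on_product:
  fixes f :: "'a \<Rightarrow> real" and g :: "'b \<Rightarrow> real"
  assumes "f summable_on A" "g summable_on B"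
    and "\<And>x. x \<in> A \<Longrightarrow> f x \<ge> 0" "\<And>y. y \<in> B \<Longrightarrow> g y \<ge> 0"
  shows "(\<lambda>(x, y). f x * g y) summable_on A \<times> B"
proof (rule summable_on_SigmaI)
  fix x assume "x \<in> A"
  show "((\<lambda>y. (\<lambda>(x, y). f x * g y) (x, y)) has_sum f x * infsum g B) B"
    using has_sum_cmult_right[OF has_sum_infsum[OF assms(2)], of "f x"] by simp
qed (use assms in \<open>auto intro: summable_on_cmult_left\<close>)

text \<open>Absolute convergence of both factors makes the product family summable, so the iterated
  sum is also the sum over pairs.\<close>

lemma has_sum_product:
  fixes f :: "'a \<Rightarrow> complex" and g :: "'b \<Rightarrow> complex"
  assumes f: "(\<lambda>x. norm (f x)) summable_on A" "(f has_sum S) A"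
    and g: "(\<lambda>x. norm (g x)) summable_on B" "(g has_sum T0) B"
  shows "((\<lambda>(x, y). f x * g y) has_sum S * T0) (A \<times> B)"
proof (rule has_sum_SigmaI)
  fix x assume "x \<in> A"
  show "((\<lambda>y. (\<lambda>(x, y). f x * g y) (x, y)) has_sum f x * T0) B"
    using has_sum_cmult_right[OF g(2), of "f x"] by simp
next
  show "((\<lambda>x. f x * T0) has_sum S * T0) A" using f(2) by (rule has_sum_cmult_left)
next
  have "(\<lambda>(x, y). norm (f x) * norm (g y)) summable_on A \<times> B"
    using f g by (intro summable_on_product) auto
  then have "(\<lambda>z. norm (case z of (x, y) \<Rightarrow> f x * g y)) summable_on A \<times> B"
    by (simp add: case_prod_unfold norm_mult)
  then show "(\<lambda>(x, y). f x * g y) summable_on A \<times> B"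
    by (rule abs_summable_summable)
qed

lemma summable_on_int_nat:
  fixes f :: "int \<Rightarrow> real"
  assumes "(\<lambda>n. f (int n)) summable_on UNIV" "(\<lambda>n. f (- int n - 1)) summable_on UNIV"
  shows "f summable_on UNIV"
proof -
  have "f summable_on range int"
    using assms(1) by (subst summable_on_reindex) (auto simp: o_def)
  moreover have "f summable_on range (\<lambda>n. - int n - 1)"
    using assms(2) by (subst summable_on_reindex) (auto simp: o_def inj_on_def)
  moreover have "range int \<inter> range (\<lambda>n. - int n - 1) = {}" by auto
  moreover have "range int \<union> range (\<lambda>n. - int n - 1) = UNIV"
  proof -
    have "x \<in> range int \<union> range (\<lambda>n. - int n - 1)" for x
      by (cases "x \<ge> 0") (auto intro: image_eqI[of _ _ "nat x"] image_eqI[of _ _ "nat (- x - 1)"])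
    then show ?thesis by auto
  qed
  ultimately show ?thesis by (metis summable_on_Un_disjoint)
qed

text \<open>Ratio test. The ratio enters as a multiplier and not as a quotient, so that terms may
  vanish.\<close>

lemma summable_ratio_tendsto_0:
  fixes f :: "nat \<Rightarrow> 'a::banach"
  assumes "\<And>n. norm (f (Suc n)) = t n * norm (f n)" "t \<longlonglongrightarrow> 0"
  shows "summable (\<lambda>n. norm (f n))"
proof -
  from order_tendstoD(2)[OF assms(2), of "1/2"] obtain N where "\<And>n. n \<ge> N \<Longrightarrow> t n < 1/2"
    by (auto simp: eventually_at_top_linorder)
  then have le: "t n * norm (f n) \<le> 1/2 * norm (f n)" if "n \<ge> N" for n
    using that by (intro mult_right_mono) (auto intro: less_imp_le)
  have step: "norm (norm (f (Suc n))) \<le> 1/2 * norm (norm (f n))" if "n \<ge> N" for n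
    unfolding real_norm_def abs_norm_cancel unfolding assms(1) by (rule le[OF that])
  show ?thesis
  proof (rule summable_ratio_test)
    show "(1 / 2 :: real) < 1" by simp
  qed (rule step)
qed

section \<open>Triangular numbers with integer index\<close>

text \<open>Negative indices are wanted too: \<open>tri (- n)\<close> is n(n-1)/2, the exponent in
  Euler's series.\<close>

definition tri :: "int \<Rightarrow> int" where "tri n = n * (n + 1) div 2"

lemma two_tri: "2 * tri n = n * (n + 1)"
  unfolding tri_def by simp

text \<open>The cross term is the source both of the factor q^(ij) in \<open>kappa_term\<close> and
  of the quasi-periodicity of theta.\<close>

lemma tri_add: "tri (m + n) = tri m + tri n + m * n"
  using two_tri[of m] two_tri[of n] two_tri[of "m + n"] by (simp add: algebra_simps)

lemma tri_minus: "tri (- n) = tri n - n"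
  using two_tri[of n] two_tri[of "- n"] by (simp add: algebra_simps)

lemma tri_Suc: "tri (int (Suc n)) = tri (int n) + int n + 1"
  using two_tri[of "int n"] two_tri[of "int (Suc n)"] by (simp add: algebra_simps)

lemma tri_0 [simp]: "tri 0 = 0"
  by (simp add: tri_def)

text \<open>Consecutive terms have ratio r^(n+1) c, which tends to 0 for every c; quadratic decay
  beats any exponential growth.\<close>

lemma summable_tri:
  fixes r c :: real
  assumes "0 < r" "r < 1" "c \<ge> 0"
  shows "summable (\<lambda>n. r powi tri (int n) * c ^ n)"
proof -
  have "summable (\<lambda>n. norm (r powi tri (int n) * c ^ n))"
  proof (rule summable_ratio_tendsto_0[where t = "\<lambda>n. r ^ Suc n * c"])
    show "(\<lambda>n. r ^ Suc n * c) \<longlonglongrightarrow> 0"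
      using assms by (intro tendsto_mult_left_zero LIMSEQ_Suc LIMSEQ_power_zero) auto
    have "r powi (tri (int n) + int n + 1) = r powi tri (int n) * r ^ Suc n" for n
      using assms by (simp add: power_int_add mult.assoc)
    then show "norm (r powi tri (int (Suc n)) * c ^ Suc n) = r ^ Suc n * c * norm (r powi tri (int n) * c ^ n)" for n
      unfolding tri_Suc using assms by (simp add: abs_mult)
  qed
  then show ?thesis using assms by (simp add: abs_mult)
qed

section \<open>Sums over integer vectors\<close>

text \<open>A copy of Z^A for an arbitrary index set, with value 0 outside A so that each vector is
  represented once. For A = {1..N} it is \<open>idxZ N\<close>; general A permits induction and the
  splitting off of coordinate 0.\<close>

definition int_vectors :: "nat set \<Rightarrow> (nat \<Rightarrow> int) set" where
  "int_vectors A = {n. \<forall>j. j \<notin> A \<longrightarrow> n j = 0}"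

lemma bij_int_vectors_insert:
  assumes "k \<notin> A"
  shows "bij_betw (\<lambda>(n, m). n(k := m)) (int_vectors A \<times> UNIV) (int_vectors (insert k A))"
  by (rule bij_betwI[where g = "\<lambda>n. (n(k := 0), n k)"])
    (use assms in \<open>auto simp: int_vectors_def fun_eq_iff\<close>)

lemma bij_int_vectors_permutes:
  assumes "\<sigma> permutes A"
  shows "bij_betw (\<lambda>n. n \<circ> \<sigma>) (int_vectors A) (int_vectors A)"
  by (rule bij_betwI[where g = "\<lambda>n. n \<circ> inv \<sigma>"])
    (use permutes_in_image[OF assms] permutes_in_image[OF permutes_inv[OF assms]]
      permutes_inverses[OF assms] in \<open>auto simp: int_vectors_def fun_eq_iff\<close>)

lemma bij_int_vectors_shift:
  assumes "r \<in> A"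
  shows "bij_betw (\<lambda>n. n(r := n r + k)) (int_vectors A) (int_vectors A)"
  by (rule bij_betwI[where g = "\<lambda>n. n(r := n r - k)"])
    (use assms in \<open>auto simp: int_vectors_def fun_eq_iff\<close>)

lemma summable_prod_int_vectors:
  fixes h :: "nat \<Rightarrow> int \<Rightarrow> real"
  assumes "finite A" "\<And>j. j \<in> A \<Longrightarrow> h j summable_on UNIV" "\<And>j m. h j m \<ge> 0"
  shows "(\<lambda>n. \<Prod>j\<in>A. h j (n j)) summable_on int_vectors A"
  using assms(1,2)
proof (induction A rule: finite_induct)
  case empty
  have "finite (int_vectors {})" by (rule finite_subset[of _ "{\<lambda>_. 0}"]) (auto simp: int_vectors_def)
  then show ?case by simp
next
  case (insert k A)
  have "(\<lambda>(n, m). (\<Prod>j\<in>A. h j (n j)) * h k m) summable_on int_vectors A \<times> UNIV"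
    using insert assms(3) by (intro summable_on_product prod_nonneg) auto
  moreover have "(\<Prod>j\<in>A. h j (n j)) * h k m = (\<Prod>j\<in>insert k A. h j ((n(k := m)) j))" for n m
  proof -
    have "(\<Prod>j\<in>A. h j ((n(k := m)) j)) = (\<Prod>j\<in>A. h j (n j))"
      using insert.hyps by (intro prod.cong) auto
    then show ?thesis using insert.hyps by (simp add: mult.commute)
  qed
  ultimately have "(\<lambda>z. \<Prod>j\<in>insert k A. h j ((case z of (n, m) \<Rightarrow> n(k := m)) j)) summable_on int_vectors A \<times> UNIV"
    by (simp add: case_prod_unfold)
  then show ?case
    using summable_on_reindex_bij_betw[OF bij_int_vectors_insert[OF insert.hyps(2)],
        of "\<lambda>n. \<Prod>j\<in>insert k A. h j (n j)"] by simp
qed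

section \<open>Infinite products and Euler's expansion\<close>

locale nonzero_disc =
  fixes q :: complex
  assumes q_nz: "q \<noteq> 0" and q_norm: "norm q < 1"
begin

text \<open>The finite Pochhammer symbol (q;q)_n.\<close>

definition qfac :: "nat \<Rightarrow> complex" where "qfac n = (\<Prod>k<n. 1 - q ^ Suc k)"

lemma q_pow_ne_1: "q ^ Suc k \<noteq> 1"
proof
  assume "q ^ Suc k = 1"
  then have "norm q ^ Suc k = 1" by (metis norm_one norm_power)
  moreover have "norm q ^ Suc k < 1" using q_norm q_nz by (intro power_Suc_less_one) auto
  ultimately show False by simp
qed

lemma qfac_nz: "qfac n \<noteq> 0"
  using q_pow_ne_1 by (simp add: qfac_def)

lemma qfac_Suc: "qfac (Suc n) = qfac n * (1 - q ^ Suc n)"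
  by (simp add: qfac_def)

lemma convergent_qpoch: "convergent_prod (\<lambda>j. 1 - x * q ^ j)"
proof -
  have "summable (\<lambda>j. norm x * norm q ^ j)"
    using q_norm by (intro summable_mult summable_geometric) auto
  then have "summable (\<lambda>j. norm (1 - x * q ^ j - 1))"
    by (simp add: norm_mult norm_power)
  then show ?thesis
    by (simp only: summable_imp_abs_convergent_prod abs_convergent_prod_imp_convergent_prod)
qed

lemma qpoch_LIMSEQ: "(\<lambda>n. \<Prod>j<n. 1 - x * q ^ j) \<longlonglongrightarrow> qpoch_inf x q"
  \<comment> \<open>\<open>convergent_prod_LIMSEQ\<close> takes products over j <= n, the claim over
    j < n; hence the shift of the index by one.\<close>
  using convergent_prod_LIMSEQ[OF convergent_qpoch, of x]
  unfolding qpoch_inf_def by (subst (asm) lessThan_Suc_atMost [symmetric]) (rule LIMSEQ_imp_Suc)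

lemma qpoch_nz: "(\<And>j. x * q ^ j \<noteq> 1) \<Longrightarrow> qpoch_inf x q \<noteq> 0"
  unfolding qpoch_inf_def by (intro prodinf_nonzero convergent_qpoch) auto

text \<open>The limit (q;q)_infinity of \<open>qfac\<close> is nonzero, so the reciprocals converge
  and are bounded.\<close>

lemma inverse_qfac_bound: obtains C where "C > 0" "\<And>n. norm (inverse (qfac n)) \<le> C"
proof -
  have "qfac \<longlonglongrightarrow> qpoch_inf q q"
    using qpoch_LIMSEQ[of q] unfolding qfac_def by simp
  moreover have "qpoch_inf q q \<noteq> 0"
    using q_pow_ne_1 by (intro qpoch_nz) auto
  ultimately have "(\<lambda>n. inverse (qfac n)) \<longlonglongrightarrow> inverse (qpoch_inf q q)"
    by (rule tendsto_inverse)
  then have "Bseq (\<lambda>n. inverse (qfac n))" by (intro convergent_imp_Bseq convergentI)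
  then show ?thesis using that by (auto elim: BseqE)
qed

definition euler_coeff :: "nat \<Rightarrow> complex" where
  "euler_coeff i = (-1) ^ i * q powi tri (- int i) / qfac i"

lemma euler_coeff_0: "euler_coeff 0 = 1" by (simp add: euler_coeff_def qfac_def)

lemma euler_coeff_Suc: "euler_coeff (Suc i) * (1 - q ^ Suc i) = - (q ^ i) * euler_coeff i"
proof -
  have "tri (- int (Suc i)) = tri (- int i) + int i"
    by (simp add: tri_minus tri_Suc del: of_nat_Suc)
  then have "q powi tri (- int (Suc i)) = q powi tri (- int i) * q ^ i"
    using q_nz by (simp add: power_int_add)
  then show ?thesis using qfac_nz[of i] q_pow_ne_1[of i]
    by (simp add: euler_coeff_def qfac_Suc field_simps del: power_Suc of_nat_Suc) simp
qed

lemma summable_euler_coeff: "summable (\<lambda>i. norm (euler_coeff i * x ^ i))"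
proof (rule summable_ratio_tendsto_0[where t = "\<lambda>i. norm (q ^ i * x / (1 - q ^ Suc i))"])
  have "(\<lambda>i. q ^ i * x / (1 - q ^ Suc i)) \<longlonglongrightarrow> 0 * x / (1 - 0)"
    using q_norm by (intro tendsto_intros LIMSEQ_Suc LIMSEQ_power_zero) auto
  then show "(\<lambda>i. norm (q ^ i * x / (1 - q ^ Suc i))) \<longlonglongrightarrow> 0"
    by (intro tendsto_norm_zero) simp
  fix i
  have "euler_coeff (Suc i) = - (q ^ i) * euler_coeff i / (1 - q ^ Suc i)"
    using euler_coeff_Suc[of i] q_pow_ne_1[of i] by (simp add: field_simps del: power_Suc)
  then have "euler_coeff (Suc i) * x ^ Suc i = - (q ^ i * x / (1 - q ^ Suc i)) * (euler_coeff i * x ^ i)"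
    by simp
  then show "norm (euler_coeff (Suc i) * x ^ Suc i) = norm (q ^ i * x / (1 - q ^ Suc i)) * norm (euler_coeff i * x ^ i)"
    by (simp only: norm_mult norm_minus_cancel)
qed

text \<open>Both sides satisfy $E(x) = (1 - x) E(qx)$ and are continuous at $0$ with value $1$.\<close>
lemma euler_identity: "(\<Sum>i. euler_coeff i * x ^ i) = qpoch_inf x q"
proof -
  define E where "E = (\<lambda>x. \<Sum>i. euler_coeff i * x ^ i)"
  have summ: "summable (\<lambda>i. euler_coeff i * x ^ i)" for x
    using summable_euler_coeff by (rule summable_norm_cancel)
  have step: "E x = (1 - x) * E (q * x)" for x
  proof -
    have 1: "(\<lambda>i. euler_coeff i * x ^ i) sums E x" "(\<lambda>i. euler_coeff i * (q * x) ^ i) sums E (q * x)"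
      unfolding E_def using summ by (auto simp: summable_sums)
    have diff: "(\<lambda>i. euler_coeff i * x ^ i - euler_coeff i * (q * x) ^ i) sums (E x - E (q * x))"
      using 1 by (rule sums_diff)
    \<comment> \<open>The coefficient recursion \<open>euler_coeff_Suc\<close> becomes the
      functional equation; the terms with index 0 cancel in E(x) - E(qx).\<close>
    have "euler_coeff (Suc i) * x ^ Suc i - euler_coeff (Suc i) * (q * x) ^ Suc i = - x * (euler_coeff i * (q * x) ^ i)" for i
    proof -
      have "euler_coeff (Suc i) * x ^ Suc i - euler_coeff (Suc i) * (q * x) ^ Suc i = euler_coeff (Suc i) * (1 - q ^ Suc i) * x ^ Suc i"
        by (simp add: algebra_simps)
      then show ?thesis unfolding euler_coeff_Suc by (simp add: power_mult_distrib)
    qed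
    moreover have "(\<lambda>i. - x * (euler_coeff i * (q * x) ^ i)) sums (- x * E (q * x))"
      using 1(2) by (rule sums_mult)
    ultimately have "(\<lambda>i. euler_coeff (Suc i) * x ^ Suc i - euler_coeff (Suc i) * (q * x) ^ Suc i) sums (- x * E (q * x))"
      by (simp only:)
    then have "(\<lambda>i. euler_coeff i * x ^ i - euler_coeff i * (q * x) ^ i) sums (- x * E (q * x) + 0)"
      by (subst (asm) sums_Suc_iff) simp
    with diff have "E x - E (q * x) = - x * E (q * x) + 0" by (rule sums_unique2)
    then show ?thesis by (simp add: algebra_simps)
  qed
  have iter: "E x = (\<Prod>j<n. 1 - x * q ^ j) * E (x * q ^ n)" for n
  proof (induction n)
    case (Suc n)
    then show ?case using step[of "x * q ^ n"] by (simp add: mult_ac)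
  qed simp
  have "(\<lambda>n. (\<Prod>j<n. 1 - x * q ^ j) * E (x * q ^ n)) \<longlonglongrightarrow> qpoch_inf x q * E 0"
  proof (intro tendsto_mult qpoch_LIMSEQ)
    have "isCont E 0"
      unfolding E_def using summ[of 1] by (intro isCont_powser[of euler_coeff 1 0]) simp_all
    moreover have "(\<lambda>n. x * q ^ n) \<longlonglongrightarrow> 0"
      using q_norm by (intro tendsto_mult_right_zero LIMSEQ_power_zero) auto
    ultimately show "(\<lambda>n. E (x * q ^ n)) \<longlonglongrightarrow> E 0"
      by (rule isCont_tendsto_compose)
  qed
  then have "E x = qpoch_inf x q * E 0"
    unfolding iter [symmetric] by (rule LIMSEQ_unique [OF tendsto_const])
  moreover have "E 0 = 1" unfolding E_def by (simp add: euler_coeff_0)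
  ultimately show ?thesis by (simp add: E_def)
qed

lemma has_sum_euler_identity: "((\<lambda>i. euler_coeff i * x ^ i) has_sum qpoch_inf x q) UNIV"
  using summable_euler_coeff[of x] euler_identity[of x]
  by (intro norm_summable_imp_has_sum) (auto simp: sums_iff summable_norm_cancel)

section \<open>The coefficients \<open>kappa\<close> and their growth\<close>

text \<open>With x = e^(2 pi i u) this is both the summand of theta, up to an elementary factor and
  a reindexing, and the numerator of each factor in \<open>mu_hat\<close>.\<close>

definition theta_term :: "complex \<Rightarrow> int \<Rightarrow> complex" where
  "theta_term x n = (-1) powi n * x powi (- n) * q powi tri n"

definition kappa_term :: "complex \<Rightarrow> nat \<times> nat \<Rightarrow> complex" where
  "kappa_term a = (\<lambda>(i, j). a ^ i * q ^ (i * j) / (qfac i * qfac j))"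

text \<open>The pairs $(p + n^-, p + n^+)$ are those $(i, j)$ with $j - i = n$.\<close>
definition kappa :: "complex \<Rightarrow> int \<Rightarrow> complex" where
  "kappa a n = (\<Sum>\<^sub>\<infinity>p. kappa_term a (p + nat (- n), p + nat n))"

text \<open>The exponents of q match since \<open>tri (- j)\<close> + j = \<open>tri j\<close> and
  the cross term of \<open>tri_add\<close> at (j, -i) is -ij. All dependence on x is then carried by
  the difference j - i.\<close>

lemma euler_coeff_product:
  assumes "x \<noteq> 0"
  shows "euler_coeff i * (x * a) ^ i * (euler_coeff j * (q / x) ^ j) = theta_term x (int j - int i) * kappa_term a (i, j)"
proof -
  have "tri (- int i) + tri (- int j) + int j = tri (int j - int i) + int (i * j)"
    using tri_add[of "int j" "- int i"] by (simp add: tri_minus)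
  then have "q powi (tri (- int i) + tri (- int j) + int j) = q powi (tri (int j - int i) + int (i * j))"
    by simp
  then have q: "q powi tri (- int i) * q powi tri (- int j) * q ^ j = q powi tri (int j - int i) * q ^ (i * j)"
    using q_nz by (simp only: power_int_add power_int_of_nat simp_thms)
  have s: "(-1) powi (int j - int i) = (-1 :: complex) ^ i * (-1) ^ j"
    by (simp add: power_int_diff flip: power_inverse) (simp add: divide_simps)
  have x: "x powi (- (int j - int i)) = x ^ i / x ^ j"
    using assms by (simp add: power_int_diff)
  have "euler_coeff i * (x * a) ^ i * (euler_coeff j * (q / x) ^ j)
    = ((-1) ^ i * (-1) ^ j) * (x ^ i / x ^ j) * (q powi tri (- int i) * q powi tri (- int j) * q ^ j) * (a ^ i / (qfac i * qfac j))"
    by (simp add: euler_coeff_def power_mult_distrib power_divide field_simps)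
  also have "\<dots> = theta_term x (int j - int i) * kappa_term a (i, j)"
    unfolding q theta_term_def kappa_term_def s x by simp
  finally show ?thesis .
qed

text \<open>A pair of naturals is determined by its difference n and its minimum p; this collects a
  double series by powers of x.\<close>

lemma bij_difference_min: "bij_betw (\<lambda>(n, p). (p + nat (- n), p + nat n)) (UNIV :: (int \<times> nat) set) UNIV"
proof (rule bij_betwI[where g = "\<lambda>(i, j). (int j - int i, min i j)"])
  show "(case (case z of (n, p) \<Rightarrow> (p + nat (- n), p + nat n)) of (i, j) \<Rightarrow> (int j - int i, min i j)) = z" for z :: "int \<times> nat"
    by (cases z; cases "fst z \<ge> 0") auto
  show "(case (case z of (i, j) \<Rightarrow> (int j - int i, min i j)) of (n, p) \<Rightarrow> (p + nat (- n), p + nat n)) = z" for z :: "nat \<times> nat"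
    by (cases z; cases "fst z \<ge> snd z") (auto simp: nat_diff_distrib)
qed auto

text \<open>Decay comes from ij >= p^2 >= p(p+1)/2, growth from |a|^i <= R^(p+|n|) with R = max(1,
  |a|). The bound is a function of n times a function of p, so that summing over p leaves
  exponential growth in n.\<close>

lemma kappa_term_bound:
  obtains C R where "C > 0" "R \<ge> 1"
    "\<And>n p. norm (kappa_term a (p + nat (- n), p + nat n)) \<le> C * R ^ nat \<bar>n\<bar> * (norm q powi tri (int p) * R ^ p)"
proof -
  obtain C where C: "C > 0" "\<And>n. norm (inverse (qfac n)) \<le> C"
    using inverse_qfac_bound by metis
  define R where "R = max 1 (norm a)"
  have R: "R \<ge> 1" "norm a \<le> R" by (auto simp: R_def)
  have "norm (kappa_term a (p + nat (- n), p + nat n)) \<le> C * C * R ^ nat \<bar>n\<bar> * (norm q powi tri (int p) * R ^ p)" for n p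
  proof -
    define i j where "i = p + nat (- n)" and "j = p + nat n"
    have ij: "i \<le> p + nat \<bar>n\<bar>" "p * p \<le> i * j"
      by (auto simp: i_def j_def intro: mult_mono)
    have "norm a ^ i \<le> R ^ i" using R by (intro power_mono) auto
    also have "\<dots> \<le> R ^ (p + nat \<bar>n\<bar>)" using ij R by (intro power_increasing) auto
    finally have 1: "norm a ^ i \<le> R ^ nat \<bar>n\<bar> * R ^ p" by (simp add: power_add mult.commute)
    have "p \<le> p * p" by (cases p) auto
    then have "tri (int p) \<le> int (p * p)"
      unfolding tri_def using of_nat_mono[of p "p * p", where 'a = int] by (simp add: algebra_simps)
    also have "\<dots> \<le> int (i * j)" using ij by (simp only: of_nat_le_iff)
    finally have "norm q powi int (i * j) \<le> norm q powi tri (int p)"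
      using q_nz q_norm by (intro power_int_decreasing) auto
    then have 2: "norm q ^ (i * j) \<le> norm q powi tri (int p)" by (simp only: power_int_of_nat)
    have "norm (kappa_term a (i, j)) = (norm a ^ i * norm q ^ (i * j)) * (norm (inverse (qfac i)) * norm (inverse (qfac j)))"
      by (simp add: kappa_term_def norm_mult norm_power norm_divide norm_inverse divide_inverse)
    also have "\<dots> \<le> (R ^ nat \<bar>n\<bar> * R ^ p * norm q powi tri (int p)) * (C * C)"
      using 1 2 C R q_nz by (intro mult_mono mult_nonneg_nonneg) auto
    finally show ?thesis by (simp add: i_def j_def mult_ac)
  qed
  then show ?thesis using C R by (intro that[of "C * C" R]) auto
qed

lemma summable_tri_nat:
  assumes "R \<ge> 1"
  shows "(\<lambda>p. norm q powi tri (int p) * R ^ p) summable_on UNIV"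
  using summable_tri[of "norm q" R] q_nz q_norm assms
  by (intro norm_summable_imp_summable_on) (simp add: abs_mult norm_power_int)

lemma kappa_term_summable: "(\<lambda>p. norm (kappa_term a (p + nat (- n), p + nat n))) summable_on UNIV"
proof -
  obtain C R where "R \<ge> 1"
    "\<And>n p. norm (kappa_term a (p + nat (- n), p + nat n)) \<le> C * R ^ nat \<bar>n\<bar> * (norm q powi tri (int p) * R ^ p)"
    using kappa_term_bound by metis
  then show ?thesis
    by (intro Infinite_Sum.abs_summable_on_comparison_test'[OF summable_on_cmult_right[OF summable_tri_nat]]) auto
qed

lemma kappa_bound:
  obtains K R where "K > 0" "R \<ge> 1" "\<And>n. norm (kappa a n) \<le> K * R ^ nat \<bar>n\<bar>"
proof -
  obtain C R where CR: "C > 0" "R \<ge> 1"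
    "\<And>n p. norm (kappa_term a (p + nat (- n), p + nat n)) \<le> C * R ^ nat \<bar>n\<bar> * (norm q powi tri (int p) * R ^ p)"
    using kappa_term_bound by metis
  define M where "M = (\<Sum>\<^sub>\<infinity>p. norm q powi tri (int p) * R ^ p)"
  have "M \<ge> 0" unfolding M_def using CR by (intro infsum_nonneg) auto
  \<comment> \<open>M + 1 replaces M because the constant has to be strictly positive.\<close>
  have "norm (kappa a n) \<le> C * (M + 1) * R ^ nat \<bar>n\<bar>" for n
  proof -
    have "norm (kappa a n) \<le> (\<Sum>\<^sub>\<infinity>p. norm (kappa_term a (p + nat (- n), p + nat n)))"
      unfolding kappa_def using kappa_term_summable by (rule norm_infsum_bound)
    also have "\<dots> \<le> (\<Sum>\<^sub>\<infinity>p. C * R ^ nat \<bar>n\<bar> * (norm q powi tri (int p) * R ^ p))"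
      using CR by (intro infsum_mono kappa_term_summable summable_on_cmult_right summable_tri_nat) auto
    also have "\<dots> = C * R ^ nat \<bar>n\<bar> * M"
      unfolding M_def by (rule infsum_cmult_right')
    also have "\<dots> \<le> C * R ^ nat \<bar>n\<bar> * (M + 1)"
      using CR by (intro mult_left_mono) auto
    finally show ?thesis by (simp add: mult_ac)
  qed
  then show ?thesis using CR \<open>M \<ge> 0\<close> by (intro that[of "C * (M + 1)" R]) auto
qed

text \<open>Euler's series at xa and at q/x are multiplied, regrouped by n = j - i, and summed over
  p first.\<close>

lemma qpoch_product_expansion:
  assumes "x \<noteq> 0"
  shows "((\<lambda>n. theta_term x n * kappa a n) has_sum qpoch_inf (x * a) q * qpoch_inf (q / x) q) UNIV"
proof -
  have "((\<lambda>(i, j). euler_coeff i * (x * a) ^ i * (euler_coeff j * (q / x) ^ j)) has_sum qpoch_inf (x * a) q * qpoch_inf (q / x) q) (UNIV \<times> UNIV)"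
    using summable_euler_coeff by (intro has_sum_product has_sum_euler_identity norm_summable_imp_summable_on) auto
  then have "((\<lambda>(i, j). theta_term x (int j - int i) * kappa_term a (i, j)) has_sum qpoch_inf (x * a) q * qpoch_inf (q / x) q) UNIV"
    by (simp add: euler_coeff_product[OF assms])
  moreover have idx: "int (p + nat n) - int (p + nat (- n)) = n" for p n by simp
  ultimately have "((\<lambda>(n, p). theta_term x n * kappa_term a (p + nat (- n), p + nat n)) has_sum qpoch_inf (x * a) q * qpoch_inf (q / x) q) (UNIV \<times> UNIV)"
    by (subst (asm) has_sum_reindex_bij_betw[OF bij_difference_min, symmetric])
      (simp only: case_prod_unfold fst_conv snd_conv idx UNIV_Times_UNIV)
  then show ?thesis
  proof (rule has_sum_SigmaD)
    fix n
    show "((\<lambda>p. (\<lambda>(n, p). theta_term x n * kappa_term a (p + nat (- n), p + nat n)) (n, p)) has_sum theta_term x n * kappa a n) UNIV"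
      unfolding kappa_def using has_sum_cmult_right[OF has_sum_infsum[OF abs_summable_summable[OF kappa_term_summable]]] by simp
  qed
qed

section \<open>Constancy of \<open>kappa 1\<close>\<close>

text \<open>The sum of q^(p^2) / (q;q)_p^2, which is 1/(q;q)_infinity by the Durfee square
  identity.\<close>

definition kappa_const :: complex where "kappa_const = kappa 1 0"

text \<open>With $F(n,i)$ the $i$-th term of \<open>kappa 1 n\<close> one has $F(n+1,i) - F(n,i) = G(i+1) - G(i)$.\<close>
lemma kappa_1_step: "kappa 1 (int (Suc n)) = kappa 1 (int n)"
proof -
  define F where "F = (\<lambda>n i. q ^ (i * (i + n)) / (qfac i * qfac (i + n)))"
  define G where "G = (\<lambda>i. (1 - q ^ i) * F n i)"
  have F: "F n sums kappa 1 (int n)" for n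
  proof -
    have "(F n has_sum kappa 1 (int n)) UNIV"
      using has_sum_infsum[OF abs_summable_summable[OF kappa_term_summable[of 1 "int n"]]]
      by (simp add: kappa_def kappa_term_def F_def)
    then show ?thesis by (rule has_sum_imp_sums)
  qed
  have "F (Suc n) i - F n i = G (Suc i) - G i" for i
  proof -
    \<comment> \<open>All terms of the telescoping identity are polynomials in powers of q times D,
      so only a polynomial identity remains.\<close>
    define D where "D = q ^ (i * (i + n)) / (qfac i * qfac (Suc (i + n)))"
    have nz: "1 - q ^ Suc i \<noteq> 0" "1 - q ^ Suc (i + n) \<noteq> 0"
      using q_pow_ne_1 by (metis right_minus_eq)+
    have "F (Suc n) i = q ^ i * D"
      by (simp add: F_def D_def power_add)
    moreover have F': "F n i = (1 - q ^ Suc (i + n)) * D"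
      using nz qfac_nz by (simp add: F_def D_def qfac_Suc del: power_Suc)
    moreover have "G (Suc i) = q ^ (i + Suc (i + n)) * D"
    proof -
      have "Suc i * (Suc i + n) = i * (i + n) + (i + Suc (i + n))" by simp
      then have "q ^ (Suc i * (Suc i + n)) = q ^ (i + Suc (i + n)) * q ^ (i * (i + n))"
        by (simp only: power_add mult.commute)
      then have "F n (Suc i) = q ^ (i + Suc (i + n)) * q ^ (i * (i + n)) / (qfac i * (1 - q ^ Suc i) * qfac (Suc (i + n)))"
        by (simp only: F_def qfac_Suc[of i] add_Suc)
      then show ?thesis using nz by (simp add: G_def D_def del: power_Suc)
    qed
    ultimately show ?thesis unfolding G_def F' by (simp add: power_add algebra_simps)
  qed
  moreover have "(\<lambda>i. G (Suc i) - G i) sums (0 - G 0)"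
  proof (rule telescope_sums)
    have "F n \<longlonglongrightarrow> 0" using F by (intro summable_LIMSEQ_zero) (rule sums_summable)
    then have "(\<lambda>i. (1 - q ^ i) * F n i) \<longlonglongrightarrow> (1 - 0) * 0"
      using q_norm by (intro tendsto_intros LIMSEQ_power_zero) auto
    then show "G \<longlonglongrightarrow> 0" by (simp add: G_def)
  qed
  moreover have "(\<lambda>i. F (Suc n) i - F n i) sums (kappa 1 (int (Suc n)) - kappa 1 (int n))"
    by (intro sums_diff F)
  \<comment> \<open>G tends to 0, and G(0) = 0 because of its factor 1 - q^0.\<close>
  ultimately have "kappa 1 (int (Suc n)) - kappa 1 (int n) = 0 - G 0"
    by (simp only: sums_unique2)
  then show ?thesis by (simp add: G_def)
qed

lemma kappa_1: "kappa 1 n = kappa_const"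
proof -
  have "kappa 1 (int m) = kappa_const" for m
    by (induction m) (use kappa_1_step in \<open>auto simp: kappa_const_def\<close>)
  \<comment> \<open>At a = 1 the terms are symmetric in i and j, and negating n exchanges
    these.\<close>
  moreover have "kappa 1 (- int m) = kappa 1 (int m)" for m
    by (simp add: kappa_def kappa_term_def mult.commute)
  ultimately show ?thesis by (cases n rule: int_cases2) auto
qed

section \<open>Theta series, quasi-periodicity and the triple product\<close>

text \<open>Since \<open>tri (- n - 1)\<close> = \<open>tri n\<close>, both halves of the series
  reduce to \<open>summable_tri\<close>. The weight R^|n| is there to absorb the growth of
  \<open>kappa\<close>.\<close>

lemma theta_term_summable:
  assumes "x \<noteq> 0" "R \<ge> 1"
  shows "(\<lambda>n. norm (theta_term x n) * R ^ nat \<bar>n\<bar>) summable_on UNIV"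
proof (rule summable_on_int_nat)
  have n: "norm (theta_term x n) = norm x powi (- n) * norm q powi tri n" for n
    by (simp add: theta_term_def norm_mult norm_power_int)
  have summ: "(\<lambda>n. c * (norm q powi tri (int n) * y ^ n)) summable_on UNIV" if "y \<ge> 0" for y c
    using summable_tri[of "norm q" y] q_nz q_norm that
    by (intro summable_on_cmult_right norm_summable_imp_summable_on) (simp add: abs_mult norm_power_int)
  have "norm (theta_term x (int n)) * R ^ nat \<bar>int n\<bar> = 1 * (norm q powi tri (int n) * (R / norm x) ^ n)" for n
    using assms by (simp add: n power_int_minus power_divide field_simps)
  then show "(\<lambda>n. norm (theta_term x (int n)) * R ^ nat \<bar>int n\<bar>) summable_on UNIV"
    using summ[of "R / norm x" 1] assms by simp
  have "norm (theta_term x (- int n - 1)) * R ^ nat \<bar>- int n - 1\<bar>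
    = (norm x * R) * (norm q powi tri (int n) * (norm x * R) ^ n)" for n
  proof -
    have "tri (- int n - 1) = tri (int n)"
      by (simp add: tri_def algebra_simps)
    moreover have "nat \<bar>- int n - 1\<bar> = Suc n" "- (- int n - 1) = int (Suc n)" by auto
    ultimately show ?thesis unfolding n by (simp only: power_int_of_nat) (simp add: power_mult_distrib mult_ac)
  qed
  then show "(\<lambda>n. norm (theta_term x (- int n - 1)) * R ^ nat \<bar>- int n - 1\<bar>) summable_on UNIV"
    using summ[of "norm x * R" "norm x * R"] assms by simp
qed

definition theta_sum :: "complex \<Rightarrow> complex" where "theta_sum x = (\<Sum>\<^sub>\<infinity>n. theta_term x n)"

lemma has_sum_theta_sum:
  assumes "x \<noteq> 0"
  shows "(theta_term x has_sum theta_sum x) UNIV"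
proof -
  have "(\<lambda>n. norm (theta_term x n)) summable_on UNIV"
    using theta_term_summable[OF assms, of 1] by simp
  then show ?thesis unfolding theta_sum_def by (rule has_sum_infsum[OF abs_summable_summable])
qed

text \<open>The multiplier of the theta series under x to x q^m; its power of q is
  q^(-m(m-1)/2).\<close>

definition shift_factor :: "complex \<Rightarrow> int \<Rightarrow> complex" where
  "shift_factor x m = (-1) powi m * x powi (- m) * q powi (- tri (- m))"

lemma shift_factor_nz: "x \<noteq> 0 \<Longrightarrow> shift_factor x m \<noteq> 0"
  using q_nz by (simp add: shift_factor_def)

lemma theta_term_shift:
  assumes "x \<noteq> 0"
  shows "theta_term (x * q powi m) n = shift_factor x m * theta_term x (n - m)"
proof -
  have "- tri (- m) + tri (n - m) = tri n - m * n"
    using tri_add[of n "- m"] by simp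
  then have "q powi (- tri (- m)) * q powi tri (n - m) = q powi (tri n - m * n)"
    using q_nz by (simp flip: power_int_add)
  also have "\<dots> = (q powi m) powi (- n) * q powi tri n"
    using q_nz by (simp add: power_int_diff power_int_minus power_int_mult field_simps)
  finally have q: "q powi (- tri (- m)) * q powi tri (n - m) = (q powi m) powi (- n) * q powi tri n" .
  have "x powi (- m) * x powi (- (n - m)) = x powi (- n)"
    using assms by (simp flip: power_int_add)
  moreover have "(-1) powi m * (-1) powi (n - m) = ((-1) powi n :: complex)"
    by (simp flip: power_int_add)
  moreover have "shift_factor x m * theta_term x (n - m) = ((-1) powi m * (-1) powi (n - m)) * (x powi (- m) * x powi (- (n - m)))
    * (q powi (- tri (- m)) * q powi tri (n - m))"
    unfolding shift_factor_def theta_term_def by (simp only: mult_ac)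
  ultimately have "shift_factor x m * theta_term x (n - m) = (-1) powi n * x powi (- n) * ((q powi m) powi (- n) * q powi tri n)"
    unfolding q by (simp only:)
  then show ?thesis by (simp add: theta_term_def power_int_mult_distrib mult_ac)
qed

text \<open>Jacobi's triple product, at m = 0, together with quasi-periodicity: for a = 1 the
  constant \<open>kappa\<close> leaves the sum, and reindexing by m restores the theta
  series.\<close>

lemma theta_product_shift:
  assumes "x \<noteq> 0"
  shows "qpoch_inf (x * q powi m) q * qpoch_inf (q / (x * q powi m)) q = shift_factor x m * (kappa_const * theta_sum x)"
proof -
  define y where "y = x * q powi m"
  have "y \<noteq> 0" using assms q_nz by (simp add: y_def)
  from qpoch_product_expansion[OF this, of 1] have "((\<lambda>n. theta_term y n * kappa_const) has_sum qpoch_inf y q * qpoch_inf (q / y) q) UNIV"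
    by (simp add: kappa_1)
  then have "((\<lambda>n. shift_factor x m * theta_term x (n - m) * kappa_const) has_sum qpoch_inf y q * qpoch_inf (q / y) q) UNIV"
    unfolding y_def theta_term_shift[OF assms] .
  moreover have "bij_betw (\<lambda>n. n - m) (UNIV :: int set) UNIV"
    by (rule bij_betwI[where g = "\<lambda>n. n + m"]) auto
  note has_sum_reindex_bij_betw[OF this, of "\<lambda>n. shift_factor x m * theta_term x n * kappa_const"]
  ultimately have "((\<lambda>n. shift_factor x m * theta_term x n * kappa_const) has_sum qpoch_inf y q * qpoch_inf (q / y) q) UNIV"
    by simp
  moreover have "((\<lambda>n. shift_factor x m * theta_term x n * kappa_const) has_sum shift_factor x m * theta_sum x * kappa_const) UNIV"
    by (intro has_sum_cmult_left has_sum_cmult_right has_sum_theta_sum assms)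
  ultimately show ?thesis using has_sum_unique by (fastforce simp: y_def mult_ac)
qed

text \<open>A vanishing factor of either product would make x an integer power of q.\<close>

lemma qpoch_int_nz:
  assumes "\<And>k::int. x \<noteq> q powi k"
  shows "qpoch_inf (x * q powi m) q \<noteq> 0" "qpoch_inf (q / (x * q powi m)) q \<noteq> 0"
proof -
  show "qpoch_inf (x * q powi m) q \<noteq> 0"
  proof (rule qpoch_nz)
    fix j show "x * q powi m * q ^ j \<noteq> 1"
    proof
      assume "x * q powi m * q ^ j = 1"
      then have "x = q powi (- (m + int j))"
        using q_nz by (simp add: power_int_add power_int_minus field_simps del: minus_add_distrib)
      then show False using assms by blast
    qed
  qed
  show "qpoch_inf (q / (x * q powi m)) q \<noteq> 0"
  proof (rule qpoch_nz)
    fix j show "q / (x * q powi m) * q ^ j \<noteq> 1"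
    proof
      assume a: "q / (x * q powi m) * q ^ j = 1"
      then have "x \<noteq> 0" by auto
      with a have "x = q powi (1 + int j - m)"
        using q_nz by (simp add: power_int_add power_int_diff field_simps)
      then show False using assms by blast
    qed
  qed
qed

text \<open>Both are factors of a triple product with no vanishing factor.\<close>

lemma theta_sum_nz:
  assumes "x \<noteq> 0" "\<And>k::int. x \<noteq> q powi k"
  shows "kappa_const \<noteq> 0" "theta_sum x \<noteq> 0"
proof -
  have "shift_factor x 0 * (kappa_const * theta_sum x) \<noteq> 0"
    unfolding theta_product_shift[OF assms(1), symmetric] using qpoch_int_nz[OF assms(2), where m = 0] by simp
  then show "kappa_const \<noteq> 0" "theta_sum x \<noteq> 0" by auto
qed

text \<open>At y = x q^m the expansions for a and for 1 share the factor (q/y;q) and the multiplier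
  \<open>shift_factor x m\<close>; both cancel in the quotient, and reindexing moves m into the
  argument of \<open>kappa\<close>.\<close>

lemma qpoch_ratio:
  assumes "x \<noteq> 0" "\<And>k::int. x \<noteq> q powi k"
  shows "((\<lambda>n. theta_term x n * kappa a (n + m)) has_sum
    qpoch_inf (x * q powi m * a) q / qpoch_inf (x * q powi m) q * (kappa_const * theta_sum x)) UNIV"
proof -
  define y where "y = x * q powi m"
  define c where "c = shift_factor x m"
  have y: "y \<noteq> 0" using assms q_nz by (simp add: y_def)
  have c: "c \<noteq> 0" using assms shift_factor_nz by (simp add: c_def)
  from qpoch_product_expansion[OF y, of a]
  have "((\<lambda>n. c * theta_term x (n - m) * kappa a n) has_sum qpoch_inf (y * a) q * qpoch_inf (q / y) q) UNIV"
    unfolding y_def theta_term_shift[OF assms(1)] c_def .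
  moreover have "bij_betw (\<lambda>n. n + m) (UNIV :: int set) UNIV"
    by (rule bij_betwI[where g = "\<lambda>n. n - m"]) auto
  note has_sum_reindex_bij_betw[OF this, of "\<lambda>n. c * theta_term x (n - m) * kappa a n"]
  ultimately have "((\<lambda>n. c * theta_term x n * kappa a (n + m)) has_sum qpoch_inf (y * a) q * qpoch_inf (q / y) q) UNIV"
    by simp
  from has_sum_cmult_right[OF this, of "1 / c"]
  have "((\<lambda>n. theta_term x n * kappa a (n + m)) has_sum qpoch_inf (y * a) q * qpoch_inf (q / y) q / c) UNIV"
    using c by (simp add: mult.assoc)
  moreover have "qpoch_inf (y * a) q * qpoch_inf (q / y) q / c = qpoch_inf (y * a) q / qpoch_inf y q * (kappa_const * theta_sum x)"
  proof -
    have "qpoch_inf y q * qpoch_inf (q / y) q = c * (kappa_const * theta_sum x)"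
      unfolding y_def c_def by (rule theta_product_shift[OF assms(1)])
    moreover have "qpoch_inf y q \<noteq> 0"
      unfolding y_def by (rule qpoch_int_nz[OF assms(2)])
    ultimately show ?thesis using c
      by (intro cross_cancel) auto
  qed
  ultimately show ?thesis by (simp only: y_def)
qed

section \<open>The symmetric lattice sum\<close>

text \<open>The offset k counts multiplications of a variable by q, and does not record which
  variable was multiplied.\<close>

definition kappa_sum :: "complex \<Rightarrow> nat set \<Rightarrow> (nat \<Rightarrow> complex) \<Rightarrow> int \<Rightarrow> complex" where
  "kappa_sum a A x k = (\<Sum>\<^sub>\<infinity>n\<in>int_vectors A. kappa a ((\<Sum>j\<in>A. n j) + k) * (\<Prod>j\<in>A. theta_term (x j) (n j)))"

text \<open>As R >= 1 and |sum of n_j| <= sum of |n_j|, the growth of \<open>kappa\<close> is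
  distributed over the coordinates, leaving a product of convergent one-variable series.\<close>

lemma kappa_sum_summable:
  assumes "finite A" "\<And>j. j \<in> A \<Longrightarrow> x j \<noteq> 0"
  shows "(\<lambda>n. kappa a (\<Sum>j\<in>A. n j) * (\<Prod>j\<in>A. theta_term (x j) (n j))) summable_on int_vectors A"
proof -
  obtain K R where KR: "K > 0" "R \<ge> 1" "\<And>n. norm (kappa a n) \<le> K * R ^ nat \<bar>n\<bar>"
    using kappa_bound by metis
  have "(\<lambda>n. norm (kappa a (\<Sum>j\<in>A. n j) * (\<Prod>j\<in>A. theta_term (x j) (n j)))) summable_on int_vectors A"
  proof (rule Infinite_Sum.abs_summable_on_comparison_test')
    show "(\<lambda>n. K * (\<Prod>j\<in>A. norm (theta_term (x j) (n j)) * R ^ nat \<bar>n j\<bar>)) summable_on int_vectors A"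
      using assms KR by (intro summable_on_cmult_right summable_prod_int_vectors theta_term_summable) auto
    fix n
    have "nat \<bar>\<Sum>j\<in>A. n j\<bar> \<le> (\<Sum>j\<in>A. nat \<bar>n j\<bar>)"
      using sum_abs[of n A] by (simp add: nat_le_iff)
    then have "R ^ nat \<bar>\<Sum>j\<in>A. n j\<bar> \<le> (\<Prod>j\<in>A. R ^ nat \<bar>n j\<bar>)"
      unfolding power_sum [symmetric] using KR by (intro power_increasing) auto
    then have "norm (kappa a (\<Sum>j\<in>A. n j)) \<le> K * (\<Prod>j\<in>A. R ^ nat \<bar>n j\<bar>)"
      using KR by (intro order_trans[OF KR(3)] mult_left_mono) auto
    then have "norm (kappa a (\<Sum>j\<in>A. n j)) * (\<Prod>j\<in>A. norm (theta_term (x j) (n j)))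
      \<le> K * (\<Prod>j\<in>A. R ^ nat \<bar>n j\<bar>) * (\<Prod>j\<in>A. norm (theta_term (x j) (n j)))"
      by (intro mult_right_mono prod_nonneg) auto
    then show "norm (kappa a (\<Sum>j\<in>A. n j) * (\<Prod>j\<in>A. theta_term (x j) (n j)))
      \<le> K * (\<Prod>j\<in>A. norm (theta_term (x j) (n j)) * R ^ nat \<bar>n j\<bar>)"
      by (simp add: norm_mult prod_norm prod.distrib mult_ac)
  qed
  then show ?thesis by (rule abs_summable_summable)
qed

text \<open>In the sum over Z^(N+1), coordinate 0 is summed first; \<open>qpoch_ratio\<close> with m
  = n_1 + ... + n_N evaluates it to the Pochhammer quotient.\<close>

lemma qpoch_sum_eq_kappa_sum:
  assumes "\<And>j. j \<le> N \<Longrightarrow> x j \<noteq> 0" "\<And>k::int. x 0 \<noteq> q powi k"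
  shows "(\<Sum>\<^sub>\<infinity>n\<in>int_vectors {1..N}. qpoch_inf (x 0 * q powi (\<Sum>j=1..N. n j) * a) q /
            qpoch_inf (x 0 * q powi (\<Sum>j=1..N. n j)) q * (\<Prod>j=1..N. theta_term (x j) (n j)))
         = kappa_sum a {0..N} x 0 / (kappa_const * theta_sum (x 0))"
proof -
  have ins: "{0..N} = insert 0 {1..N}" by auto
  define f where "f = (\<lambda>n. kappa a (\<Sum>j\<in>{0..N}. n j) * (\<Prod>j\<in>{0..N}. theta_term (x j) (n j)))"
  define P where "P = (\<lambda>n. \<Prod>j=1..N. theta_term (x j) (n j))"
  define c where "c = (\<lambda>n. qpoch_inf (x 0 * q powi (\<Sum>j=1..N. n j) * a) q /
            qpoch_inf (x 0 * q powi (\<Sum>j=1..N. n j)) q * P n)"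
  have x0: "x 0 \<noteq> 0" using assms(1) by simp
  have "f summable_on int_vectors {0..N}"
    unfolding f_def by (rule kappa_sum_summable) (use assms in auto)
  from has_sum_infsum[OF this]
  have "(f has_sum kappa_sum a {0..N} x 0) (int_vectors (insert 0 {1..N}))"
    unfolding ins [symmetric] by (simp only: kappa_sum_def f_def add_0_right)
  then have "((\<lambda>z. f (case z of (n, m) \<Rightarrow> n(0 := m))) has_sum kappa_sum a {0..N} x 0) (int_vectors {1..N} \<times> UNIV)"
    by (subst has_sum_reindex_bij_betw[OF bij_int_vectors_insert]) auto
  then have "((\<lambda>n. c n * (kappa_const * theta_sum (x 0))) has_sum kappa_sum a {0..N} x 0) (int_vectors {1..N})"
  proof (rule has_sum_SigmaD)
    fix n :: "nat \<Rightarrow> int"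
    have "f (n(0 := m)) = theta_term (x 0) m * kappa a (m + (\<Sum>j=1..N. n j)) * P n" for m
    proof -
      have "(\<Sum>j=1..N. (n(0 := m)) j) = (\<Sum>j=1..N. n j)" "P (n(0 := m)) = P n"
        unfolding P_def by (auto intro: sum.cong prod.cong)
      then show ?thesis unfolding f_def ins P_def by simp
    qed
    moreover have "((\<lambda>m. theta_term (x 0) m * kappa a (m + (\<Sum>j=1..N. n j)) * P n) has_sum c n * (kappa_const * theta_sum (x 0))) UNIV"
      using has_sum_cmult_left[OF qpoch_ratio[OF x0 assms(2), of a "\<Sum>j=1..N. n j"], of "P n"]
      by (simp add: c_def mult_ac)
    ultimately show "((\<lambda>m. f (case (n, m) of (n, m) \<Rightarrow> n(0 := m))) has_sum c n * (kappa_const * theta_sum (x 0))) UNIV"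
      by simp
  qed
  from has_sum_divide_const[OF this, of "kappa_const * theta_sum (x 0)"]
  have "(c has_sum kappa_sum a {0..N} x 0 / (kappa_const * theta_sum (x 0))) (int_vectors {1..N})"
    using theta_sum_nz[OF x0 assms(2)] by simp
  then show ?thesis using infsumI by (fastforce simp: c_def P_def)
qed

text \<open>Permuting the summation vector along with the variables changes neither the sum of the
  entries nor the product.\<close>

lemma kappa_sum_permutes:
  assumes "\<sigma> permutes A"
  shows "kappa_sum a A (x \<circ> \<sigma>) k = kappa_sum a A x k"
proof -
  have "kappa_sum a A (x \<circ> \<sigma>) k
    = (\<Sum>\<^sub>\<infinity>n\<in>int_vectors A. kappa a ((\<Sum>j\<in>A. (n \<circ> \<sigma>) j) + k) * (\<Prod>j\<in>A. theta_term ((x \<circ> \<sigma>) j) ((n \<circ> \<sigma>) j)))"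
    unfolding kappa_sum_def
    by (subst infsum_reindex_bij_betw[OF bij_int_vectors_permutes[OF assms], symmetric]) simp
  also have "\<dots> = kappa_sum a A x k"
    unfolding kappa_sum_def
  proof (intro infsum_cong arg_cong2[where f = "(*)"] arg_cong2[where f = kappa] arg_cong2[where f = "(+)"] refl)
    show "(\<Sum>j\<in>A. (n \<circ> \<sigma>) j) = (\<Sum>j\<in>A. n j)" for n :: "nat \<Rightarrow> int"
      using sum.permute[OF assms, of n] by simp
    show "(\<Prod>j\<in>A. theta_term ((x \<circ> \<sigma>) j) ((n \<circ> \<sigma>) j)) = (\<Prod>j\<in>A. theta_term (x j) (n j))" for n
      using prod.permute[OF assms, of "\<lambda>j. theta_term (x j) (n j)"] by (simp add: o_def)
  qed
  finally show ?thesis .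
qed

lemma theta_term_shift_1:
  assumes "x \<noteq> 0"
  shows "theta_term (x * q) n = - inverse x * theta_term x (n - 1)"
  using theta_term_shift[OF assms, of 1 n] by (simp add: shift_factor_def tri_def power_int_minus)

lemma theta_sum_shift:
  assumes "x \<noteq> 0"
  shows "theta_sum (x * q) = - inverse x * theta_sum x"
proof -
  have "bij_betw (\<lambda>n. n - 1) (UNIV :: int set) UNIV"
    by (rule bij_betwI[where g = "\<lambda>n. n + 1"]) auto
  from infsum_reindex_bij_betw[OF this, of "theta_term x"] show ?thesis
    unfolding theta_sum_def theta_term_shift_1[OF assms] by (simp only: infsum_cmult_right')
qed

text \<open>Raising n_r by 1 undoes the index shift of \<open>theta_term_shift_1\<close> and
  increases the argument of \<open>kappa\<close> by 1. The factor -1/x_r is the one in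
  \<open>theta_sum_shift\<close>, so it cancels in \<open>mu_hat_shift\<close>.\<close>

lemma kappa_sum_shift:
  assumes "finite A" "r \<in> A" "x r \<noteq> 0"
  shows "kappa_sum a A (x(r := x r * q)) k = - inverse (x r) * kappa_sum a A x (k + 1)"
proof -
  let ?f = "\<lambda>n. kappa a ((\<Sum>j\<in>A. n j) + k) * (\<Prod>j\<in>A. theta_term ((x(r := x r * q)) j) (n j))"
  have "kappa_sum a A (x(r := x r * q)) k = (\<Sum>\<^sub>\<infinity>n\<in>int_vectors A. ?f (n(r := n r + 1)))"
    unfolding kappa_sum_def
    by (subst infsum_reindex_bij_betw[OF bij_int_vectors_shift[OF assms(2)], symmetric]) simp
  moreover have "?f (n(r := n r + 1)) = - inverse (x r) * (kappa a ((\<Sum>j\<in>A. n j) + (k + 1)) * (\<Prod>j\<in>A. theta_term (x j) (n j)))" for n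
  proof -
    have "(\<Sum>j\<in>A. (n(r := n r + 1)) j) = (\<Sum>j\<in>A. n j) + 1"
    proof -
      have "(\<Sum>j\<in>A - {r}. (n(r := n r + 1)) j) = (\<Sum>j\<in>A - {r}. n j)"
        by (intro sum.cong) auto
      then show ?thesis
        using sum.remove[OF assms(1,2), of n] sum.remove[OF assms(1,2), of "n(r := n r + 1)"] by simp
    qed
    moreover have "(\<Prod>j\<in>A. theta_term ((x(r := x r * q)) j) ((n(r := n r + 1)) j)) = - inverse (x r) * (\<Prod>j\<in>A. theta_term (x j) (n j))"
    proof -
      have "(\<Prod>j\<in>A - {r}. theta_term ((x(r := x r * q)) j) ((n(r := n r + 1)) j)) = (\<Prod>j\<in>A - {r}. theta_term (x j) (n j))"
        by (intro prod.cong) auto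
      then show ?thesis
        using prod.remove[OF assms(1,2), of "\<lambda>j. theta_term (x j) (n j)"]
          prod.remove[OF assms(1,2), of "\<lambda>j. theta_term ((x(r := x r * q)) j) ((n(r := n r + 1)) j)"]
          theta_term_shift_1[OF assms(3), of "n r + 1"] by simp
    qed
    ultimately show ?thesis by (simp add: ac_simps)
  qed
  ultimately show ?thesis unfolding kappa_sum_def by (simp only: infsum_cmult_right')
qed

end

section \<open>Return to the variables u, \<alpha> and \<tau>\<close>

lemma nonzero_disc_nome: "Im \<tau> > 0 \<Longrightarrow> nonzero_disc (nome \<tau>)"
  by standard (auto simp: nome_def norm_exp_eq_Re)

lemma nome_powi: "nome \<tau> powi n = qpow \<tau> (of_int n)"
  by (simp add: nome_def qpow_def exp_power_int mult_ac)

text \<open>Equality of the exponentials would give u = m + k \<tau> with integers m and k.\<close>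

lemma nome_powi_neq:
  assumes "u \<notin> lattice \<tau>"
  shows "exp (2 * pi * \<i> * u) \<noteq> nome \<tau> powi k"
proof
  assume "exp (2 * pi * \<i> * u) = nome \<tau> powi k"
  then obtain m :: int where "2 * pi * \<i> * u = of_int k * (2 * pi * \<i> * \<tau>) + of_int (2 * m) * pi * \<i>"
    unfolding nome_def exp_power_int exp_eq by blast
  then have "(2 * pi * \<i>) * u = (2 * pi * \<i>) * (of_int m + of_int k * \<tau>)"
    by (simp add: algebra_simps)
  then have "u = of_int m + of_int k * \<tau>" by simp
  then show False using assms by (auto simp: lattice_def)
qed

text \<open>The index k = -n-1 gives \<nu> = -(n + 1/2), hence \<nu>^2/2 = n(n+1)/2 + 1/8 and a
  power x^(-n), as in \<open>theta_term\<close>.\<close>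

lemma theta_eq_theta_sum:
  assumes "Im \<tau> > 0"
  shows "theta u \<tau> = - \<i> * exp (- pi * \<i> * u) * qpow \<tau> (1 / 8) * nonzero_disc.theta_sum (nome \<tau>) (exp (2 * pi * \<i> * u))"
proof -
  interpret nonzero_disc "nome \<tau>" using nonzero_disc_nome[OF assms] .
  define t where "t = (\<lambda>k::int. exp (2 * pi * \<i> * (of_int k + 1/2) * (u + 1/2)) * qpow \<tau> ((of_int k + 1/2)^2 / 2))"
  have "bij_betw (\<lambda>n. - n - 1) (UNIV :: int set) UNIV"
    by (rule bij_betwI[where g = "\<lambda>n. - n - 1"]) auto
  then have "theta u \<tau> = (\<Sum>\<^sub>\<infinity>n. t (- n - 1))"
    unfolding theta_def Let_def t_def by (subst infsum_reindex_bij_betw) auto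
  moreover have "t (- n - 1) = - \<i> * exp (- pi * \<i> * u) * qpow \<tau> (1 / 8) * theta_term (exp (2 * pi * \<i> * u)) n" for n
  proof -
    have i: "- \<i> = exp (- (pi * \<i> / 2))"
      by (simp add: exp_eq_polar complex_eq_iff)
    \<comment> \<open>This choice of logarithm makes the exponents on both sides equal outright, not
      merely modulo 2 pi i.\<close>
    have m: "(-1 :: complex) = exp (- (pi * \<i>))"
      by (simp add: exp_minus)
    have tri: "2 * (of_int (tri n) :: complex) = of_int n * (of_int n + 1)"
      using two_tri[of n] by (metis of_int_1 of_int_add of_int_mult of_int_numeral)
    have "theta_term (exp (2 * pi * \<i> * u)) n = exp (of_int n * - (pi * \<i>)) * exp (of_int (- n) * (2 * pi * \<i> * u)) * exp (of_int (tri n) * (2 * pi * \<i> * \<tau>))"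
      unfolding theta_term_def unfolding nome_def by (subst m) (simp only: exp_power_int)
    also have "of_int (tri n) * (2 * pi * \<i> * \<tau>) = of_int n * (of_int n + 1) * pi * \<i> * \<tau>"
      using tri by (simp add: mult_ac)
    finally show ?thesis
      unfolding i t_def qpow_def by (simp add: algebra_simps power2_eq_square flip: exp_add) (simp add: field_simps)
  qed
  ultimately show ?thesis unfolding theta_sum_def by (simp only: infsum_cmult_right')
qed

text \<open>Each 1/theta(u_j) with j >= 1 contributes e^(pi i u_j), and e^(pi i u_0) is present in
  the summand; together they turn \<alpha> - 1 into \<alpha> in the prefactor. The missing
  denominator \<open>theta_sum (x 0)\<close> comes from \<open>qpoch_sum_eq_kappa_sum\<close>, and
  every factor is now symmetric.\<close>

lemma mu_hat_eq_kappa_sum: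
  assumes "Im \<tau> > 0" "\<And>j. j \<le> N \<Longrightarrow> u j \<notin> lattice \<tau>"
  defines "x \<equiv> \<lambda>j. exp (2 * pi * \<i> * u j)"
  shows "mu_hat N u \<alpha> \<tau> = exp (pi * \<i> * \<alpha> * (\<Sum>j\<in>{0..N}. u j)) * (\<i> / qpow \<tau> (1 / 8)) ^ N / nonzero_disc.kappa_const (nome \<tau>) *
    (nonzero_disc.kappa_sum (nome \<tau>) (qpow \<tau> \<alpha>) {0..N} x 0 / (\<Prod>j\<in>{0..N}. nonzero_disc.theta_sum (nome \<tau>) (x j)))"
proof -
  interpret nonzero_disc "nome \<tau>" using nonzero_disc_nome[OF assms(1)] .
  define c where "c = (\<lambda>n. qpoch_inf (x 0 * nome \<tau> powi (\<Sum>j=1..N. n j) * qpow \<tau> \<alpha>) (nome \<tau>) /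
            qpoch_inf (x 0 * nome \<tau> powi (\<Sum>j=1..N. n j)) (nome \<tau>) * (\<Prod>j=1..N. theta_term (x j) (n j)))"
  define Th where "Th = (\<Prod>j=1..N. theta (u j) \<tau>)"
  define PT where "PT = (\<Prod>j=1..N. theta_sum (x j))"
  define S where "S = (\<Sum>j=1..N. u j)"
  have fac: "((-1) powi n j) * exp (- 2 * pi * \<i> * of_int (n j) * u j) *
             qpow \<tau> (of_int (n j * (n j + 1) div 2)) = theta_term (x j) (n j)" for n :: "nat \<Rightarrow> int" and j
    unfolding theta_term_def x_def nome_powi tri_def by (simp add: exp_power_int mult_ac)
  have shift: "qpow \<tau> (\<alpha> + of_int m) = nome \<tau> powi m * qpow \<tau> \<alpha>" for m
    unfolding nome_powi by (simp add: qpow_def algebra_simps flip: exp_add)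
  have "mu_hat N u \<alpha> \<tau> = exp (pi * \<i> * (\<alpha> - 1) * (\<Sum>j\<le>N. u j)) *
     (\<Sum>\<^sub>\<infinity>n\<in>int_vectors {1..N}. exp (pi * \<i> * u 0) / Th * c n)"
    unfolding mu_hat_def Let_def prod_dividef fac shift c_def Th_def unfolding nome_powi [symmetric]
    by (simp add: idxZ_def int_vectors_def x_def mult_ac)
  also have "\<dots> = exp (pi * \<i> * (\<alpha> - 1) * (\<Sum>j\<le>N. u j)) * (exp (pi * \<i> * u 0) / Th * (kappa_sum (qpow \<tau> \<alpha>) {0..N} x 0 / (kappa_const * theta_sum (x 0))))"
    unfolding infsum_cmult_right' c_def
    by (subst qpoch_sum_eq_kappa_sum) (use nome_powi_neq[OF assms(2)] in \<open>auto simp: x_def\<close>)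
  also have "1 / Th = exp (pi * \<i> * S) * (\<i> / qpow \<tau> (1 / 8)) ^ N / PT"
  proof -
    have "1 / theta v \<tau> = exp (pi * \<i> * v) * (\<i> / qpow \<tau> (1 / 8)) / theta_sum (exp (2 * pi * \<i> * v))" for v
      unfolding theta_eq_theta_sum[OF assms(1)] by (simp add: exp_minus divide_simps)
    then have "(\<Prod>j=1..N. 1 / theta (u j) \<tau>) = (\<Prod>j=1..N. exp (pi * \<i> * u j) * (\<i> / qpow \<tau> (1 / 8)) / theta_sum (x j))"
      by (simp add: x_def)
    then show ?thesis
      by (simp add: Th_def PT_def S_def prod_dividef prod.distrib sum_distrib_left exp_sum power_divide)
  qed
  then have "exp (pi * \<i> * u 0) / Th = exp (pi * \<i> * u 0) * (exp (pi * \<i> * S) * (\<i> / qpow \<tau> (1 / 8)) ^ N / PT)"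
    by (metis mult.right_neutral times_divide_eq_right)
  also have "(\<Sum>j\<le>N. u j) = u 0 + S"
    unfolding S_def atMost_atLeast0 by (simp add: sum.atLeast_Suc_atMost)
  finally have "mu_hat N u \<alpha> \<tau> = (exp (pi * \<i> * (\<alpha> - 1) * (u 0 + S)) * exp (pi * \<i> * u 0) * exp (pi * \<i> * S)) * (\<i> / qpow \<tau> (1 / 8)) ^ N / kappa_const
      * (kappa_sum (qpow \<tau> \<alpha>) {0..N} x 0 / (theta_sum (x 0) * PT))"
    by (simp add: mult_ac)
  also have "exp (pi * \<i> * (\<alpha> - 1) * (u 0 + S)) * exp (pi * \<i> * u 0) * exp (pi * \<i> * S) = exp (pi * \<i> * \<alpha> * (\<Sum>j\<in>{0..N}. u j))"
    unfolding S_def by (simp add: sum.atLeast_Suc_atMost algebra_simps flip: exp_add)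
  also have "theta_sum (x 0) * PT = (\<Prod>j\<in>{0..N}. theta_sum (x j))"
    unfolding PT_def by (simp add: prod.atLeast_Suc_atMost)
  finally show ?thesis .
qed

lemma lattice_shift: "u \<notin> lattice \<tau> \<Longrightarrow> u + \<tau> \<notin> lattice \<tau>"
proof
  assume "u \<notin> lattice \<tau>" "u + \<tau> \<in> lattice \<tau>"
  then obtain k m :: int where "u + \<tau> = of_int k + of_int m * \<tau>"
    by (auto simp: lattice_def)
  then have "u = of_int k + of_int (m - 1) * \<tau>" by (simp add: algebra_simps)
  with \<open>u \<notin> lattice \<tau>\<close> show False unfolding lattice_def by blast
qed

text \<open>The factors -1/x_r from \<open>kappa_sum\<close> and from the product of
  \<open>theta_sum\<close> cancel. The right-hand side is free of r, which is claim (a).\<close>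

lemma mu_hat_shift:
  assumes "Im \<tau> > 0" "\<And>j. j \<le> N \<Longrightarrow> u j \<notin> lattice \<tau>" "r \<le> N"
  defines "x \<equiv> \<lambda>j. exp (2 * pi * \<i> * u j)"
  shows "mu_hat N (u(r := u r + \<tau>)) \<alpha> \<tau> =
    exp (pi * \<i> * \<alpha> * ((\<Sum>j\<in>{0..N}. u j) + \<tau>)) * (\<i> / qpow \<tau> (1 / 8)) ^ N / nonzero_disc.kappa_const (nome \<tau>) *
    (nonzero_disc.kappa_sum (nome \<tau>) (qpow \<tau> \<alpha>) {0..N} x 1 / (\<Prod>j\<in>{0..N}. nonzero_disc.theta_sum (nome \<tau>) (x j)))"
proof -
  interpret nonzero_disc "nome \<tau>" using nonzero_disc_nome[OF assms(1)] .
  have r: "r \<in> {0..N}" "x r \<noteq> 0" using assms by auto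
  have xr: "exp (2 * pi * \<i> * (u(r := u r + \<tau>)) j) = (x(r := x r * nome \<tau>)) j" for j
    by (auto simp: x_def nome_def algebra_simps simp flip: exp_add)
  have lat: "(u(r := u r + \<tau>)) j \<notin> lattice \<tau>" if "j \<le> N" for j
    using assms(2) lattice_shift that by simp
  have usum: "(\<Sum>j\<in>{0..N}. (u(r := u r + \<tau>)) j) = (\<Sum>j\<in>{0..N}. u j) + \<tau>"
  proof -
    have "(\<Sum>j\<in>{0..N} - {r}. (u(r := u r + \<tau>)) j) = (\<Sum>j\<in>{0..N} - {r}. u j)"
      by (intro sum.cong) auto
    then show ?thesis
      using r sum.remove[of "{0..N}" r u] sum.remove[of "{0..N}" r "u(r := u r + \<tau>)"] by simp
  qed
  have Tprod: "(\<Prod>j\<in>{0..N}. theta_sum ((x(r := x r * nome \<tau>)) j)) = - inverse (x r) * (\<Prod>j\<in>{0..N}. theta_sum (x j))"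
  proof -
    have "(\<Prod>j\<in>{0..N} - {r}. theta_sum ((x(r := x r * nome \<tau>)) j)) = (\<Prod>j\<in>{0..N} - {r}. theta_sum (x j))"
      by (intro prod.cong) auto
    then show ?thesis
      using r prod.remove[of "{0..N}" r "\<lambda>j. theta_sum (x j)"] theta_sum_shift[of "x r"]
        prod.remove[of "{0..N}" r "\<lambda>j. theta_sum ((x(r := x r * nome \<tau>)) j)"] by simp
  qed
  have ksum: "kappa_sum (qpow \<tau> \<alpha>) {0..N} (x(r := x r * nome \<tau>)) 0 = - inverse (x r) * kappa_sum (qpow \<tau> \<alpha>) {0..N} x 1"
    using kappa_sum_shift[of "{0..N}" r x _ 0] r by simp
  show ?thesis
    using mu_hat_eq_kappa_sum[where u = "u(r := u r + \<tau>)" and N = N and \<alpha> = \<alpha>,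
        OF assms(1), unfolded xr usum Tprod ksum, OF lat] r(2) by simp
qed

lemma mu_hat_permutes:
  assumes "Im \<tau> > 0" "\<And>j. j \<le> N \<Longrightarrow> u j \<notin> lattice \<tau>" "\<sigma> permutes {0..N}"
  shows "mu_hat N (u \<circ> \<sigma>) \<alpha> \<tau> = mu_hat N u \<alpha> \<tau>"
proof -
  interpret nonzero_disc "nome \<tau>" using nonzero_disc_nome[OF assms(1)] .
  define x where "x = (\<lambda>j. exp (2 * pi * \<i> * u j))"
  have "(u \<circ> \<sigma>) j \<notin> lattice \<tau>" if "j \<le> N" for j
    using assms(2) permutes_in_image[OF assms(3), of j] that by simp
  note eq = mu_hat_eq_kappa_sum[where u = "u \<circ> \<sigma>" and \<alpha> = \<alpha>, OF assms(1) this]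
  have "(\<lambda>j. exp (2 * pi * \<i> * (u \<circ> \<sigma>) j)) = x \<circ> \<sigma>"
    by (auto simp: x_def)
  moreover have "(\<Prod>j\<in>{0..N}. theta_sum (exp (2 * pi * \<i> * (u \<circ> \<sigma>) j))) = (\<Prod>j\<in>{0..N}. theta_sum (x j))"
    using prod.permute[OF assms(3), of "\<lambda>j. theta_sum (x j)"] by (simp add: o_def x_def)
  moreover have "(\<Sum>j\<in>{0..N}. (u \<circ> \<sigma>) j) = (\<Sum>j\<in>{0..N}. u j)"
    using sum.permute[OF assms(3), of u] by simp
  ultimately show ?thesis
    using eq mu_hat_eq_kappa_sum[where u = u and \<alpha> = \<alpha>, OF assms(1,2)] kappa_sum_permutes[OF assms(3)]
    by (simp only: x_def simp_thms)
qed

theorem theorem1p1: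
  fixes N :: nat and \<alpha> \<tau> :: complex and u :: "nat \<Rightarrow> complex"
  assumes "Im \<tau> > 0" and "N \<ge> 1"
    and "\<forall>j\<le>N. u j \<notin> lattice \<tau>"
  shows "(\<forall>r\<le>N. \<forall>s\<le>N.
            mu_hat N (u(r := u r + \<tau>)) \<alpha> \<tau> = mu_hat N (u(s := u s + \<tau>)) \<alpha> \<tau>)
       \<and> (\<forall>\<sigma>. \<sigma> permutes {0..N} \<longrightarrow> mu_hat N u \<alpha> \<tau> = mu_hat N (u \<circ> \<sigma>) \<alpha> \<tau>)"
  using assms by (auto simp: mu_hat_shift mu_hat_permutes)

end
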